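(* Let $T$ be a semi-infinite banded stochastic matrix admitting a positive bidiagonal factorization, let $N\in\mathbb N_0$, let $T^{[N]}$ be its $(N+1)\times(N+1)$ leading principal submatrix, let $\lambda_0^{[N]}>0$ be the largest eigenvalue of $T^{[N]}$ and $u_0^{\langle N\rangle}$ a right eigenvector of $T^{[N]}$ for $\lambda^{[N]}_0$ with all entries positive. Then the matrix $$\hat T^{[N]}:=\frac{1}{\lambda_0^{[N]}}\,\delta(u_0^{\langle N\rangle})^{-1}\,T^{[N]}\,\delta(u_0^{\langle N\rangle})$$ is stochastic.
   Context: Semi-infinite matrices are indexed by $\mathbb N_0=\{0,1,2,\dots\}$. Fix integers $p,q\ge1$. $T$ is banded: $T_{n,m}=0$ unless $n-p\le m\le n+q$, with positive entries inside the band. A (finite or semi-infinite) matrix is stochastic if its entries are nonnegative and every row sums to $1$. A positive bidiagonal factorization of $T$ is a factorization $T=\mathscr L_1\cdots\mathscr L_p\mathscr U_q\cdots\mathscr U_1$ where each $\mathscr L_i$ is lower bidiagonal with positive entries on the main diagonal and first subdiagonal (all other entries zero) and each $\mathscr U_j$ is upper bidiagonal with positive entries on the main diagonal and first superdiagonal (all other entries zero). For a vector $v$, $\delta(v)$ is the diagonal matrix with diagonal entries the entries of $v$. $T^{[N]}=(T_{n,m})_{n,m=0}^N$. Known facts: $T^{[N]}$ is an oscillatory matrix, its eigenvalues $\lambda_0^{[N]}>\lambda_1^{[N]}>\dots>\lambda_N^{[N]}$ are simple and positive, and by Perron--Frobenius the eigenvalue $\lambda_0^{[N]}$ has a right eigenvector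 with all entries positive, unique up to positive scaling. *)

theory Defs
  imports
    "Jordan_Normal_Form.Gauss_Jordan_Elimination"
    "Jordan_Normal_Form.Char_Poly"
begin

type_synonym semi_inf_mat = "nat \<Rightarrow> nat \<Rightarrow> real"

definition si_one :: semi_inf_mat where
  "si_one n m = (if n = m then 1 else 0)"

text \<open>
  The series has only finitely many nonzero terms as soon as the left factor has finite
  rows. Right-nested products of banded matrices, as formed by \<open>si_prod_list\<close>, therefore
  involve finite sums only and do not depend on the bracketing.
\<close>

definition si_times :: "semi_inf_mat \<Rightarrow> semi_inf_mat \<Rightarrow> semi_inf_mat" where
  "si_times A B n m = (\<Sum>k. A n k * B k m)"

definition si_prod_list :: "semi_inf_mat list \<Rightarrow> semi_inf_mat" where
  "si_prod_list As = foldr si_times As si_one"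

text \<open>
  The band condition \<open>n - p \<le> m \<le> n + q\<close> is written without subtraction, which
  truncates on natural numbers.
\<close>

definition positive_banded :: "nat \<Rightarrow> nat \<Rightarrow> semi_inf_mat \<Rightarrow> bool" where
  "positive_banded p q T \<longleftrightarrow>
     (\<forall>n m. if n \<le> m + p \<and> m \<le> n + q then 0 < T n m else T n m = 0)"

definition positive_lower_bidiagonal :: "semi_inf_mat \<Rightarrow> bool" where
  "positive_lower_bidiagonal L \<longleftrightarrow>
     (\<forall>n m. if n = m \<or> n = Suc m then 0 < L n m else L n m = 0)"

definition positive_upper_bidiagonal :: "semi_inf_mat \<Rightarrow> bool" where
  "positive_upper_bidiagonal U \<longleftrightarrow>
     (\<forall>n m. if n = m \<or> m = Suc n then 0 < U n m else U n m = 0)"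

text \<open>The list below is \<open>L 1, ..., L p, U q, ..., U 1\<close>; the upper factors come in descending order.\<close>

definition has_positive_bidiagonal_factorization ::
  "nat \<Rightarrow> nat \<Rightarrow> semi_inf_mat \<Rightarrow> bool" where
  "has_positive_bidiagonal_factorization p q T \<longleftrightarrow>
     (\<exists>L U :: nat \<Rightarrow> semi_inf_mat.
        (\<forall>i\<in>{1..p}. positive_lower_bidiagonal (L i)) \<and>
        (\<forall>j\<in>{1..q}. positive_upper_bidiagonal (U j)) \<and>
        T = si_prod_list (map L [1..<Suc p] @ map U (rev [1..<Suc q])))"

definition si_stochastic :: "semi_inf_mat \<Rightarrow> bool" where
  "si_stochastic T \<longleftrightarrow> (\<forall>n m. 0 \<le> T n m) \<and> (\<forall>n. (\<lambda>m. T n m) sums 1)"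

definition stochastic_mat :: "real mat \<Rightarrow> bool" where
  "stochastic_mat A \<longleftrightarrow>
     (\<forall>i<dim_row A. \<forall>j<dim_col A. 0 \<le> A $$ (i, j)) \<and>
     (\<forall>i<dim_row A. (\<Sum>j<dim_col A. A $$ (i, j)) = 1)"

definition leading_submat :: "semi_inf_mat \<Rightarrow> nat \<Rightarrow> real mat" where
  "leading_submat T N = mat (N + 1) (N + 1) (\<lambda>(n, m). T n m)"

definition delta :: "real vec \<Rightarrow> real mat" where
  "delta v = mat_diag (dim_vec v) (\<lambda>i. v $ i)"

text \<open>
  \<open>mat_inverse\<close> returns an option; it is \<open>Some\<close> of the two-sided inverse exactly for
  invertible square matrices.
\<close>

definition mat_inv :: "real mat \<Rightarrow> real mat" where
  "mat_inv A = the (mat_inverse A)"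

text \<open>
  The comparison ranges over real eigenvalues only. The truncations this is applied to are
  oscillatory, so they have no others.
\<close>

definition largest_eigenvalue :: "real mat \<Rightarrow> real \<Rightarrow> bool" where
  "largest_eigenvalue A l \<longleftrightarrow> eigenvalue A l \<and> (\<forall>\<mu>. eigenvalue A \<mu> \<longrightarrow> \<mu> \<le> l)"

end

theory Submission
  imports Defs
begin

text \<open>This is the Doob transform of a nonnegative matrix by a positive eigenvector.
  Conjugating \<open>A\<close> by \<open>delta v\<close> replaces the entry at (i, j) by its product
  with v_j / v_i (\<open>delta_conjugate\<close>), so row i then sums to (A v)_i / v_i, which is the
  eigenvalue. Dividing by the eigenvalue makes every row sum 1, and positivity of \<open>v\<close>
  and of the eigenvalue preserves nonnegativity
  (\<open>stochastic_mat_eigenvector_conjugate\<close>).\<close>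

text \<open>Gives access to \<open>mat_inv\<close>, which is defined through an option: a known
  two-sided inverse rules out \<open>None\<close>, and uniqueness of inverses identifies the
  result.\<close>

lemma mat_inv_eqI:
  assumes A: "A \<in> carrier_mat n n" and B: "B \<in> carrier_mat n n"
    and AB: "A * B = 1\<^sub>m n" and BA: "B * A = 1\<^sub>m n"
  shows "mat_inv A = B"
proof (cases "mat_inverse A")
  case None
  \<comment> \<open>\<open>None\<close> is returned only for matrices that are not units, so the
    witness \<open>B\<close> refutes this case.\<close>
  have "A \<in> Units (ring_mat TYPE(real) n ())"
    using A B AB BA unfolding Units_def by (auto simp: ring_mat_simps)
  with mat_inverse(1)[OF A None, of "()"] show ?thesis by blast
next
  case (Some C)
  from mat_inverse(2)[OF A Some] have C: "C \<in> carrier_mat n n" "C * A = 1\<^sub>m n"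
    by auto
  have "C = C * (A * B)" using AB C(1) by simp
  also have "\<dots> = (C * A) * B" using A B C(1) by simp
  also have "\<dots> = B" using C(2) B by simp
  finally show ?thesis using Some by (simp add: mat_inv_def)
qed

lemma mat_inv_delta:
  assumes "\<forall>i<dim_vec v. v $ i \<noteq> 0"
  shows "mat_inv (delta v) = mat_diag (dim_vec v) (\<lambda>i. inverse (v $ i))"
proof (rule mat_inv_eqI)
  show "delta v * mat_diag (dim_vec v) (\<lambda>i. inverse (v $ i)) = 1\<^sub>m (dim_vec v)"
    "mat_diag (dim_vec v) (\<lambda>i. inverse (v $ i)) * delta v = 1\<^sub>m (dim_vec v)"
    unfolding delta_def mat_diag_diag using assms by (auto simp: mat_diag_def)
qed (auto simp: delta_def)

text \<open>A diagonal factor on the left scales rows and one on the right scales columns.\<close>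

lemma delta_conjugate:
  assumes A: "A \<in> carrier_mat (dim_vec v) (dim_vec v)"
    and v: "\<forall>i<dim_vec v. v $ i \<noteq> 0"
  shows "mat_inv (delta v) * A * delta v
    = mat (dim_vec v) (dim_vec v) (\<lambda>(i, j). A $$ (i, j) * v $ j / v $ i)"
proof -
  let ?n = "dim_vec v"
  have "mat_inv (delta v) * A = mat ?n ?n (\<lambda>(i, j). inverse (v $ i) * A $$ (i, j))"
    unfolding mat_inv_delta[OF v] by (rule mat_diag_mult_left[OF A])
  then show ?thesis
    unfolding delta_def
    by (subst mat_diag_mult_right[of _ ?n]) (auto simp: divide_simps)
qed

lemma stochastic_mat_eigenvector_conjugate:
  assumes A: "A \<in> carrier_mat n n"
    and nonneg: "\<And>i j. i < n \<Longrightarrow> j < n \<Longrightarrow> 0 \<le> A $$ (i, j)"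
    and l: "0 < l"
    and ev: "eigenvector A v l"
    and v: "\<forall>i<dim_vec v. 0 < v $ i"
  shows "stochastic_mat ((1 / l) \<cdot>\<^sub>m (mat_inv (delta v) * A * delta v))"
proof -
  from ev A have n: "dim_vec v = n" and eq: "A *\<^sub>v v = l \<cdot>\<^sub>v v"
    by (auto simp: eigenvector_def)
  \<comment> \<open>The eigenvector equation read in coordinate i; it evaluates the row sums
    below.\<close>
  have row: "(\<Sum>j<n. A $$ (i, j) * v $ j) = l * v $ i" if "i < n" for i
  proof -
    have "(A *\<^sub>v v) $ i = (\<Sum>j<n. A $$ (i, j) * v $ j)"
      using that A n by (auto simp: scalar_prod_def lessThan_atLeast0)
    then show ?thesis using eq that n by simp
  qed
  have conj: "mat_inv (delta v) * A * delta v = mat n n (\<lambda>(i, j). A $$ (i, j) * v $ j / v $ i)"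
    using delta_conjugate[of A v] A n v by force
  \<comment> \<open>Both 1 / l and 1 / v_i are constant along row i, so they leave the sum and
    cancel against l * v_i, which is nonzero.\<close>
  have "(\<Sum>j<n. 1 / l * (A $$ (i, j) * v $ j / v $ i)) = 1" if "i < n" for i
  proof -
    have "(\<Sum>j<n. 1 / l * (A $$ (i, j) * v $ j / v $ i))
      = 1 / l * ((\<Sum>j<n. A $$ (i, j) * v $ j) / v $ i)"
      by (simp only: sum_divide_distrib sum_distrib_left)
    also have "\<dots> = 1" using row[OF that] v n that l by fastforce
    finally show ?thesis .
  qed
  moreover have "0 \<le> 1 / l * (A $$ (i, j) * v $ j / v $ i)" if "i < n" "j < n" for i j
    using nonneg[OF that] v n that l by (simp add: less_imp_le)
  ultimately show ?thesis
    unfolding conj stochastic_mat_def by simp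
qed

theorem proposition2p5:
  fixes p q N :: nat
    and T :: semi_inf_mat
    and lam0 :: real
    and u0 :: "real vec"
  assumes "1 \<le> p" and "1 \<le> q"
    and "positive_banded p q T"
    and "si_stochastic T"
    and "has_positive_bidiagonal_factorization p q T"
    and "largest_eigenvalue (leading_submat T N) lam0"
    and "0 < lam0"
    and "eigenvector (leading_submat T N) u0 lam0"
    and "\<forall>i<dim_vec u0. 0 < u0 $ i"
  shows "stochastic_mat
    ((1 / lam0) \<cdot>\<^sub>m (mat_inv (delta u0) * leading_submat T N * delta u0))"
proof (rule stochastic_mat_eigenvector_conjugate)
  show "leading_submat T N \<in> carrier_mat (N + 1) (N + 1)"
    by (simp add: leading_submat_def)
  \<comment> \<open>Nonnegativity passes from \<open>T\<close> to its truncation. Row sums may drop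
    below 1 there, and the conjugation restores them.\<close>
  show "0 \<le> leading_submat T N $$ (i, j)" if "i < N + 1" "j < N + 1" for i j
    using that \<open>si_stochastic T\<close> by (simp add: leading_submat_def si_stochastic_def)
qed (use assms in auto)

end
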